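(* Let $(\rho_k,u_k)_{k=1,\dots,d}$ be a solution to the generalized Riemann problem or to the generalized Cauchy problem with (sufficiently regular) initial data $(\hat\rho_k,\hat u_k)$, and let $(\bar\rho_k,\bar u_k)=(\rho_k,u_k)(t,0+)$ be the traces at the junction. Then: (i) At the junction energy is non-increasing, i.e. $$\sum_{k=1}^dA_k\,G(\bar\rho_k,\bar u_k)\le0\quad\text{for a.e. }t>0,\qquad G(\rho,u)=\frac{\rho u^3}2+\frac{\gamma\kappa}{\gamma-1}\rho^\gamma u.$$ (ii) The traces of the stagnation enthalpy $h(\rho,u)=\frac{u^2}2+\frac{\kappa\gamma}{\gamma-1}\rho^{\gamma-1}$ are related by $$h(\bar\rho_k,\bar u_k)\le h(\rho_*,0)\le h(\bar\rho_l,\bar u_l)$$ for all $1\le k,l\le d$ with $\bar u_l\le0\le\bar u_k$, for a.e. $t>0$, where $\rho_*=\rho_*(t)$ is the artificial density of the solution.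
   Context: Let $\kappa>0$, $1<\gamma<3$, $\theta=\frac{\gamma-1}2$, $a_\gamma=\frac{2\sqrt{\gamma\kappa}}{\gamma-1}$, $d\in\mathbb N$, $A_1,\dots,A_d>0$, and $D=\{(x_0,x_1)\in\mathbb R^2:x_0>0\text{ or }x_0=x_1=0\}$. The isentropic gas equations are $\partial_t\rho+\partial_x(\rho u)=0$, $\partial_t(\rho u)+\partial_x(\rho u^2+\kappa\rho^\gamma)=0$, with eigenvalues $\lambda_1=u-\sqrt{\kappa\gamma}\rho^\theta$, $\lambda_2=u+\sqrt{\kappa\gamma}\rho^\theta$. Entropies: with $\lambda=\frac1{\gamma-1}-\frac12$, $J_\lambda=\int_{-1}^1(1-z^2)^\lambda\mathrm{d}z$, $c_{\gamma,\kappa}=a_\gamma^{-2/(\gamma-1)}/J_\lambda$, $\chi(\rho,\xi)=c_{\gamma,\kappa}(a_\gamma^2\rho^{\gamma-1}-\xi^2)_+^\lambda$, each convex $S\colon\mathbb R\to\mathbb R$ defines $\eta_S(\rho,u)=\int_{\mathbb R}\chi(\rho,v-u)S(v)\,\mathrm{d}v$, $G_S(\rho,u)=\int_{\mathbb R}[(1-\theta)u+\theta v]\chi(\rho,v-u)S(v)\,\mathrm{d}v$; $S(v)=v^2/2$ gives the physical energy $\eta=\frac{\rho u^2}2+\frac{\kappa}{\gamma-1}\rho^\gamma$ and energy flux $G$. A weak entropy solution is a (bounded) weak solution with $\partial_t\eta_S(\rho,u)+\partial_xG_S(\rho,u)\le0$ in the sense of distributions for all these pairs. Lax solution of the standard Riemann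 problem. $\mathcal{RP}(\rho_l,u_l,\rho_r,u_r)(x/t)$ denotes the self-similar weak entropy solution in the sense of Lax with data $(\rho_l,u_l)$ for $x<0$, $(\rho_r,u_r)$ for $x>0$: a 1-wave (1-rarefaction or 1-shock) followed by a 2-wave (2-rarefaction or 2-shock), with rarefactions to/from vacuum $(0,0)$ if vacuum occurs. For $(\rho_b,u_b)\in D$, $\mathcal V(\rho_b,u_b)$ is the set of states $(\rho,u)\in D$ with $(\rho,u)=\mathcal{RP}(\rho_b,u_b,\rho_r,u_r)(0+)$ for some $(\rho_r,u_r)\in D$. Generalized Riemann problem: $(\rho_k,u_k)\colon(0,\infty)_t\times(0,\infty)_x\to D$, $k=1,\dots,d$, is a solution with constant initial data $(\hat\rho_k,\hat u_k)\in D$ if $(\rho_k,u_k)(0+,x)=(\hat\rho_k,\hat u_k)$ for all $x>0$; there is $\rho_*\ge0$ (the artificial density), independent of $k$, such that each $(\rho_k,u_k)$ is the restriction to $x>0$ of the Lax solution of the standard Riemann problem with data $(\rho_*,0)$ for $x<0$ and $(\hat\rho_k,\hat u_k)$ for $x>0$; and $\sum_kA_k\bar\rho_k\bar u_k=0$. Generalized Cauchy problem: let $U^0\in D^d$ be a constant vector of states (in conserved variables $(\rho,\rho u)$), $\hat U=(\hat\rho_1,\hat\rho_1\hat u_1,\dots,\hat\rho_d,\hat\rho_d\hat u_d)\in U^0+L^1(0,\infty)_x$ with $(\hat\rho_k,\hat\rho_k\hat u_k)\in D$ a.e., and $T\in(0,\infty]$. $(\rho_1,\rho_1u_1,\dots,\rho_d,\rho_du_d)\in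 C([0,T]_t,U^0+L^1(0,\infty)_x)$ is a solution with initial data $\hat U$ if each $(\rho_k,\rho_ku_k)$ is a weak entropy solution to the isentropic gas equations on $x>0$ and: (CP0) $(\rho_k,u_k)(0+,x)=(\hat\rho_k,\hat u_k)(x)$ for a.e. $x>0$; (CP1) for a.e. $t$ there is $\rho_*(t)\ge0$ (the artificial density) such that the traces $(\bar\rho_k,\bar u_k)(t)=(\rho_k,u_k)(t,0+)$ (assumed to exist) satisfy $(\bar\rho_k,\bar u_k)(t)\in\mathcal V(\rho_*(t),0)$ for all $k$; (CP2) $\sum_{k=1}^dA_k\bar\rho_k\bar u_k=0$ for a.e. $t$. "Sufficiently regular initial data" means only that such a solution exists; in the Cauchy case "a.e. $t>0$" means a.e. $t$ in the existence interval. *)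

theory Defs
  imports "HOL-Analysis.Analysis"
begin

section \<open>States and the isentropic gas equations\<close>

text \<open>A state is a pair \<open>(\<rho>, u)\<close> of density and velocity; vacuum is the single state \<open>(0, 0)\<close>.\<close>

definition states :: "(real \<times> real) set" where
  "states = {(x0, x1). x0 > 0 \<or> (x0 = 0 \<and> x1 = 0)}"

definition conserved :: "real \<times> real \<Rightarrow> real \<times> real" where
  "conserved V = (fst V, fst V * snd V)"

definition pressure :: "real \<Rightarrow> real \<Rightarrow> real \<Rightarrow> real" where
  "pressure \<kappa> \<gamma> \<rho> = \<kappa> * \<rho> powr \<gamma>"

text \<open>The flux of the isentropic gas equations for the conserved variables \<open>(\<rho>, \<rho>u)\<close>.\<close>

definition flux :: "real \<Rightarrow> real \<Rightarrow> real \<times> real \<Rightarrow> real \<times> real" where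
  "flux \<kappa> \<gamma> V = (fst V * snd V, fst V * (snd V)\<^sup>2 + pressure \<kappa> \<gamma> (fst V))"

definition theta :: "real \<Rightarrow> real" where
  "theta \<gamma> = (\<gamma> - 1) / 2"

definition a_const :: "real \<Rightarrow> real \<Rightarrow> real" where
  "a_const \<kappa> \<gamma> = 2 * sqrt (\<gamma> * \<kappa>) / (\<gamma> - 1)"

definition lambda1 :: "real \<Rightarrow> real \<Rightarrow> real \<times> real \<Rightarrow> real" where
  "lambda1 \<kappa> \<gamma> V = snd V - sqrt (\<kappa> * \<gamma>) * fst V powr theta \<gamma>"

definition lambda2 :: "real \<Rightarrow> real \<Rightarrow> real \<times> real \<Rightarrow> real" where
  "lambda2 \<kappa> \<gamma> V = snd V + sqrt (\<kappa> * \<gamma>) * fst V powr theta \<gamma>"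

text \<open>Riemann invariants: \<open>riemann_inv2\<close> is constant across 1-rarefactions and
  \<open>riemann_inv1\<close> across 2-rarefactions.\<close>

definition riemann_inv1 :: "real \<Rightarrow> real \<Rightarrow> real \<times> real \<Rightarrow> real" where
  "riemann_inv1 \<kappa> \<gamma> V = snd V - a_const \<kappa> \<gamma> * fst V powr theta \<gamma>"

definition riemann_inv2 :: "real \<Rightarrow> real \<Rightarrow> real \<times> real \<Rightarrow> real" where
  "riemann_inv2 \<kappa> \<gamma> V = snd V + a_const \<kappa> \<gamma> * fst V powr theta \<gamma>"

definition energy_flux :: "real \<Rightarrow> real \<Rightarrow> real \<times> real \<Rightarrow> real" where
  "energy_flux \<kappa> \<gamma> V =
     fst V * snd V ^ 3 / 2 + \<gamma> * \<kappa> / (\<gamma> - 1) * fst V powr \<gamma> * snd V"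

definition stagnation_enthalpy :: "real \<Rightarrow> real \<Rightarrow> real \<times> real \<Rightarrow> real" where
  "stagnation_enthalpy \<kappa> \<gamma> V =
     (snd V)\<^sup>2 / 2 + \<kappa> * \<gamma> / (\<gamma> - 1) * fst V powr (\<gamma> - 1)"


section \<open>Weak entropy solutions\<close>

definition lambda_exp :: "real \<Rightarrow> real" where
  "lambda_exp \<gamma> = 1 / (\<gamma> - 1) - 1 / 2"

definition J_const :: "real \<Rightarrow> real" where
  "J_const \<gamma> = (LINT z:{-1..1}|lborel. (1 - z\<^sup>2) powr lambda_exp \<gamma>)"

definition c_const :: "real \<Rightarrow> real \<Rightarrow> real" where
  "c_const \<kappa> \<gamma> = a_const \<kappa> \<gamma> powr (- 2 / (\<gamma> - 1)) / J_const \<gamma>"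

definition chi :: "real \<Rightarrow> real \<Rightarrow> real \<Rightarrow> real \<Rightarrow> real" where
  "chi \<kappa> \<gamma> \<rho> \<xi> = c_const \<kappa> \<gamma> *
     (max 0 ((a_const \<kappa> \<gamma>)\<^sup>2 * \<rho> powr (\<gamma> - 1) - \<xi>\<^sup>2)) powr lambda_exp \<gamma>"

definition eta_S :: "real \<Rightarrow> real \<Rightarrow> (real \<Rightarrow> real) \<Rightarrow> real \<times> real \<Rightarrow> real" where
  "eta_S \<kappa> \<gamma> S V = (LINT v|lborel. chi \<kappa> \<gamma> (fst V) (v - snd V) * S v)"

definition G_S :: "real \<Rightarrow> real \<Rightarrow> (real \<Rightarrow> real) \<Rightarrow> real \<times> real \<Rightarrow> real" where
  "G_S \<kappa> \<gamma> S V = (LINT v|lborel.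
     ((1 - theta \<gamma>) * snd V + theta \<gamma> * v) * chi \<kappa> \<gamma> (fst V) (v - snd V) * S v)"

primrec C_k :: "nat \<Rightarrow> ('a::euclidean_space \<Rightarrow> real) \<Rightarrow> bool" where
  "C_k 0 f \<longleftrightarrow> continuous_on UNIV f"
| "C_k (Suc n) f \<longleftrightarrow> f differentiable_on UNIV \<and>
     (\<forall>b\<in>Basis. C_k n (\<lambda>x. frechet_derivative f (at x) b))"

text \<open>\<open>C\<^sup>\<infinity>\<close> functions whose compact support lies in the open set \<open>\<Omega>\<close>.\<close>

definition test_function :: "'a::euclidean_space set \<Rightarrow> ('a \<Rightarrow> real) \<Rightarrow> bool" where
  "test_function \<Omega> \<phi> \<longleftrightarrow> (\<forall>n. C_k n \<phi>) \<and>
     (\<exists>K. compact K \<and> K \<subseteq> \<Omega> \<and> (\<forall>p. p \<notin> K \<longrightarrow> \<phi> p = 0))"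

text \<open>Points of space-time are pairs \<open>(t, x)\<close>.  The following is the distribution
  \<open>\<partial>\<^sub>t f + \<partial>\<^sub>x g\<close> on \<open>\<Omega>\<close>, applied to \<open>\<phi>\<close>.\<close>

definition dist_div ::
  "(real \<times> real) set \<Rightarrow> (real \<times> real \<Rightarrow> real) \<Rightarrow> (real \<times> real \<Rightarrow> real) \<Rightarrow>
   (real \<times> real \<Rightarrow> real) \<Rightarrow> real" where
  "dist_div \<Omega> f g \<phi> = - (LINT p:\<Omega>|lebesgue.
     f p * frechet_derivative \<phi> (at p) (1, 0) + g p * frechet_derivative \<phi> (at p) (0, 1))"

definition half_strip :: "ereal \<Rightarrow> (real \<times> real) set" where
  "half_strip T = {(t, x). 0 < t \<and> ereal t < T \<and> 0 < x}"

definition weak_entropy_solution ::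
  "real \<Rightarrow> real \<Rightarrow> ereal \<Rightarrow> (real \<Rightarrow> real \<Rightarrow> real \<times> real) \<Rightarrow> bool" where
  "weak_entropy_solution \<kappa> \<gamma> T V \<longleftrightarrow>
     (let \<Omega> = half_strip T; W = (\<lambda>(t, x). V t x) in
       set_borel_measurable lebesgue \<Omega> W \<and>
       (\<exists>B. AE p in lebesgue. p \<in> \<Omega> \<longrightarrow> norm (W p) \<le> B) \<and>
       (AE p in lebesgue. p \<in> \<Omega> \<longrightarrow> W p \<in> states) \<and>
       (\<forall>\<phi>. test_function \<Omega> \<phi> \<longrightarrow>
          dist_div \<Omega> (\<lambda>p. fst (conserved (W p))) (\<lambda>p. fst (flux \<kappa> \<gamma> (W p))) \<phi> = 0 \<and>
          dist_div \<Omega> (\<lambda>p. snd (conserved (W p))) (\<lambda>p. snd (flux \<kappa> \<gamma> (W p))) \<phi> = 0) \<and>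
       (\<forall>S \<phi>. convex_on UNIV S \<and> test_function \<Omega> \<phi> \<and> (\<forall>p. 0 \<le> \<phi> p) \<longrightarrow>
          dist_div \<Omega> (\<lambda>p. eta_S \<kappa> \<gamma> S (W p)) (\<lambda>p. G_S \<kappa> \<gamma> S (W p)) \<phi> \<le> 0))"


section \<open>Lax solutions of the standard Riemann problem\<close>

definition rankine_hugoniot ::
  "real \<Rightarrow> real \<Rightarrow> real \<times> real \<Rightarrow> real \<times> real \<Rightarrow> real \<Rightarrow> bool" where
  "rankine_hugoniot \<kappa> \<gamma> L R s \<longleftrightarrow>
     s *\<^sub>R (conserved R - conserved L) = flux \<kappa> \<gamma> R - flux \<kappa> \<gamma> L"

text \<open>A Lax \<open>i\<close>-shock satisfies \<open>\<lambda>\<^sub>i(R) < s < \<lambda>\<^sub>i(L)\<close>, together with \<open>s < \<lambda>\<^sub>2(R)\<close> if \<open>i = 1\<close>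
  and \<open>\<lambda>\<^sub>1(L) < s\<close> if \<open>i = 2\<close>.\<close>

definition shock1 ::
  "real \<Rightarrow> real \<Rightarrow> real \<times> real \<Rightarrow> real \<times> real \<Rightarrow> real \<Rightarrow> bool" where
  "shock1 \<kappa> \<gamma> L R s \<longleftrightarrow> fst L > 0 \<and> fst R > 0 \<and> rankine_hugoniot \<kappa> \<gamma> L R s \<and>
     lambda1 \<kappa> \<gamma> R < s \<and> s < lambda1 \<kappa> \<gamma> L \<and> s < lambda2 \<kappa> \<gamma> R"

definition shock2 ::
  "real \<Rightarrow> real \<Rightarrow> real \<times> real \<Rightarrow> real \<times> real \<Rightarrow> real \<Rightarrow> bool" where
  "shock2 \<kappa> \<gamma> L R s \<longleftrightarrow> fst L > 0 \<and> fst R > 0 \<and> rankine_hugoniot \<kappa> \<gamma> L R s \<and>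
     lambda2 \<kappa> \<gamma> R < s \<and> s < lambda2 \<kappa> \<gamma> L \<and> lambda1 \<kappa> \<gamma> L < s"

text \<open>A profile is a function \<open>v\<close> of \<open>\<xi> = x/t\<close>.  Centred rarefactions on the open sector
  \<open>s < \<xi> < s'\<close> are described by \<open>\<lambda>\<^sub>i(v \<xi>) = \<xi>\<close> and the constancy (\<open>= w\<close>) of the Riemann
  invariant of the other family.\<close>

definition fan1 ::
  "real \<Rightarrow> real \<Rightarrow> real \<Rightarrow> real \<Rightarrow> real \<Rightarrow> (real \<Rightarrow> real \<times> real) \<Rightarrow> bool" where
  "fan1 \<kappa> \<gamma> w s s' v \<longleftrightarrow> (\<forall>\<xi>. s < \<xi> \<and> \<xi> < s' \<longrightarrow>
     v \<xi> \<in> states \<and> lambda1 \<kappa> \<gamma> (v \<xi>) = \<xi> \<and> riemann_inv2 \<kappa> \<gamma> (v \<xi>) = w)"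

definition fan2 ::
  "real \<Rightarrow> real \<Rightarrow> real \<Rightarrow> real \<Rightarrow> real \<Rightarrow> (real \<Rightarrow> real \<times> real) \<Rightarrow> bool" where
  "fan2 \<kappa> \<gamma> w s s' v \<longleftrightarrow> (\<forall>\<xi>. s < \<xi> \<and> \<xi> < s' \<longrightarrow>
     v \<xi> \<in> states \<and> lambda2 \<kappa> \<gamma> (v \<xi>) = \<xi> \<and> riemann_inv1 \<kappa> \<gamma> (v \<xi>) = w)"

text \<open>\<open>wave1 \<kappa> \<gamma> L R s s' v\<close>: the profile \<open>v\<close> joins \<open>L\<close> to \<open>R\<close> by a 1-wave occupying the
  sector between the speeds \<open>s \<le> s'\<close>.  The four alternatives are: rarefaction (trivial if
  \<open>L = R\<close>), shock, rarefaction to vacuum (where \<open>\<lambda>\<^sub>1\<close> tends to the constant value of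
  \<open>riemann_inv2\<close>, which is therefore the speed of the vacuum boundary), and no wave because
  there is vacuum on both sides; in the last case the speed is immaterial.\<close>

definition wave1 ::
  "real \<Rightarrow> real \<Rightarrow> real \<times> real \<Rightarrow> real \<times> real \<Rightarrow> real \<Rightarrow> real \<Rightarrow> (real \<Rightarrow> real \<times> real) \<Rightarrow> bool"
  where
  "wave1 \<kappa> \<gamma> L R s s' v \<longleftrightarrow>
     (fst L > 0 \<and> fst R > 0 \<and> s = lambda1 \<kappa> \<gamma> L \<and> s' = lambda1 \<kappa> \<gamma> R \<and> s \<le> s' \<and>
        riemann_inv2 \<kappa> \<gamma> R = riemann_inv2 \<kappa> \<gamma> L \<and> fan1 \<kappa> \<gamma> (riemann_inv2 \<kappa> \<gamma> L) s s' v) \<or>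
     (s' = s \<and> shock1 \<kappa> \<gamma> L R s) \<or>
     (fst L > 0 \<and> R = (0, 0) \<and> s = lambda1 \<kappa> \<gamma> L \<and> s' = riemann_inv2 \<kappa> \<gamma> L \<and>
        fan1 \<kappa> \<gamma> (riemann_inv2 \<kappa> \<gamma> L) s s' v) \<or>
     (L = (0, 0) \<and> R = (0, 0) \<and> s' = s)"

definition wave2 ::
  "real \<Rightarrow> real \<Rightarrow> real \<times> real \<Rightarrow> real \<times> real \<Rightarrow> real \<Rightarrow> real \<Rightarrow> (real \<Rightarrow> real \<times> real) \<Rightarrow> bool"
  where
  "wave2 \<kappa> \<gamma> L R s s' v \<longleftrightarrow>
     (fst L > 0 \<and> fst R > 0 \<and> s = lambda2 \<kappa> \<gamma> L \<and> s' = lambda2 \<kappa> \<gamma> R \<and> s \<le> s' \<and>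
        riemann_inv1 \<kappa> \<gamma> L = riemann_inv1 \<kappa> \<gamma> R \<and> fan2 \<kappa> \<gamma> (riemann_inv1 \<kappa> \<gamma> R) s s' v) \<or>
     (s' = s \<and> shock2 \<kappa> \<gamma> L R s) \<or>
     (L = (0, 0) \<and> fst R > 0 \<and> s = riemann_inv1 \<kappa> \<gamma> R \<and> s' = lambda2 \<kappa> \<gamma> R \<and>
        fan2 \<kappa> \<gamma> (riemann_inv1 \<kappa> \<gamma> R) s s' v) \<or>
     (L = (0, 0) \<and> R = (0, 0) \<and> s' = s)"

text \<open>\<open>v\<close> is the profile of the Lax solution with data \<open>L\<close> (\<open>x < 0\<close>) and \<open>R\<close> (\<open>x > 0\<close>).
  The values at the at most four edge speeds are left open, since the solution is only
  determined almost everywhere; one-sided limits are not affected by this.\<close>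

definition lax_solution ::
  "real \<Rightarrow> real \<Rightarrow> real \<times> real \<Rightarrow> real \<times> real \<Rightarrow> (real \<Rightarrow> real \<times> real) \<Rightarrow> bool" where
  "lax_solution \<kappa> \<gamma> L R v \<longleftrightarrow> (\<exists>M\<in>states. \<exists>s1 s2 s3 s4.
     s2 \<le> s3 \<and> wave1 \<kappa> \<gamma> L M s1 s2 v \<and> wave2 \<kappa> \<gamma> M R s3 s4 v \<and>
     (\<forall>\<xi><s1. v \<xi> = L) \<and> (\<forall>\<xi>. s2 < \<xi> \<and> \<xi> < s3 \<longrightarrow> v \<xi> = M) \<and> (\<forall>\<xi>>s4. v \<xi> = R))"

definition V_set :: "real \<Rightarrow> real \<Rightarrow> real \<times> real \<Rightarrow> (real \<times> real) set" where
  "V_set \<kappa> \<gamma> B = {V \<in> states. \<exists>R\<in>states. \<exists>v.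
     lax_solution \<kappa> \<gamma> B R v \<and> (v \<longlongrightarrow> V) (at_right 0)}"


section \<open>The generalized Riemann and Cauchy problems\<close>

text \<open>The trace at \<open>x = 0+\<close> is an essential limit (null sets of \<open>x\<close> are disregarded).  Convergence
  is required in the conserved variables; on \<open>states\<close> they determine the state \<open>V\<close>.\<close>

definition junction_trace :: "(real \<Rightarrow> real \<times> real) \<Rightarrow> real \<times> real \<Rightarrow> bool" where
  "junction_trace f V \<longleftrightarrow> V \<in> states \<and>
     ((\<lambda>x. conserved (f x)) \<longlongrightarrow> conserved V) (inf (at_right 0) (ae_filter lebesgue))"

text \<open>\<open>V k t x\<close> is the state of the \<open>k\<close>-th solution component, \<open>Vbar k t\<close> its trace at the junction,
  \<open>\<rho>s\<close> the artificial density.\<close>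

definition gen_riemann_solution ::
  "real \<Rightarrow> real \<Rightarrow> nat \<Rightarrow> (nat \<Rightarrow> real) \<Rightarrow> (nat \<Rightarrow> real \<times> real) \<Rightarrow>
   (nat \<Rightarrow> real \<Rightarrow> real \<Rightarrow> real \<times> real) \<Rightarrow> (nat \<Rightarrow> real \<Rightarrow> real \<times> real) \<Rightarrow> real \<Rightarrow> bool" where
  "gen_riemann_solution \<kappa> \<gamma> d A Vhat V Vbar \<rho>s \<longleftrightarrow>
     (\<forall>k\<in>{1..d}. Vhat k \<in> states) \<and>
     (\<forall>k\<in>{1..d}. \<forall>t>0. \<forall>x>0. V k t x \<in> states) \<and>
     (\<forall>k\<in>{1..d}. \<forall>x>0. ((\<lambda>t. V k t x) \<longlongrightarrow> Vhat k) (at_right 0)) \<and>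
     \<rho>s \<ge> 0 \<and>
     (\<forall>k\<in>{1..d}. \<exists>v. lax_solution \<kappa> \<gamma> (\<rho>s, 0) (Vhat k) v \<and>
        (\<forall>t>0. \<forall>x>0. V k t x = v (x / t))) \<and>
     (\<forall>t>0. \<forall>k\<in>{1..d}. junction_trace (V k t) (Vbar k t)) \<and>
     (\<forall>t>0. (\<Sum>k = 1..d. A k * fst (Vbar k t) * snd (Vbar k t)) = 0)"

text \<open>For \<open>T = \<infinity>\<close> the closed time interval \<open>[0, T]\<close> is read as \<open>[0, \<infinity>)\<close>.\<close>

definition time_interval :: "ereal \<Rightarrow> real set" where
  "time_interval T = {t. 0 \<le> t \<and> ereal t \<le> T}"

definition L1_dist :: "(real \<Rightarrow> real \<times> real) \<Rightarrow> (real \<Rightarrow> real \<times> real) \<Rightarrow> real" where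
  "L1_dist f g = (LINT x:{0<..}|lebesgue. norm (f x - g x))"

definition C_L1 :: "ereal \<Rightarrow> real \<times> real \<Rightarrow> (real \<Rightarrow> real \<Rightarrow> real \<times> real) \<Rightarrow> bool" where
  "C_L1 T U0 U \<longleftrightarrow>
     (\<forall>t\<in>time_interval T. set_integrable lebesgue {0<..} (\<lambda>x. U t x - U0)) \<and>
     (\<forall>t\<in>time_interval T. ((\<lambda>s. L1_dist (U s) (U t)) \<longlongrightarrow> 0) (at t within time_interval T))"

definition gen_cauchy_solution ::
  "real \<Rightarrow> real \<Rightarrow> nat \<Rightarrow> (nat \<Rightarrow> real) \<Rightarrow> (nat \<Rightarrow> real \<times> real) \<Rightarrow> (nat \<Rightarrow> real \<Rightarrow> real \<times> real) \<Rightarrow>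
   ereal \<Rightarrow> (nat \<Rightarrow> real \<Rightarrow> real \<Rightarrow> real \<times> real) \<Rightarrow> (nat \<Rightarrow> real \<Rightarrow> real \<times> real) \<Rightarrow>
   (real \<Rightarrow> real) \<Rightarrow> bool" where
  "gen_cauchy_solution \<kappa> \<gamma> d A U0 Vhat T V Vbar \<rho>s \<longleftrightarrow>
     0 < T \<and>
     (\<forall>k\<in>{1..d}. U0 k \<in> states) \<and>
     (\<forall>k\<in>{1..d}. set_integrable lebesgue {0<..} (\<lambda>x. conserved (Vhat k x) - U0 k)) \<and>
     (\<forall>k\<in>{1..d}. AE x in lebesgue. 0 < x \<longrightarrow> conserved (Vhat k x) \<in> states) \<and>
     (\<forall>k\<in>{1..d}. C_L1 T (U0 k) (\<lambda>t x. conserved (V k t x))) \<and>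
     (\<forall>k\<in>{1..d}. weak_entropy_solution \<kappa> \<gamma> T (V k)) \<and>
     (\<forall>k\<in>{1..d}. ((\<lambda>t. L1_dist (\<lambda>x. conserved (V k t x)) (\<lambda>x. conserved (Vhat k x)))
        \<longlongrightarrow> 0) (at_right 0)) \<and>
     (AE t in lebesgue. 0 < t \<and> ereal t < T \<longrightarrow>
        (\<forall>k\<in>{1..d}. junction_trace (V k t) (Vbar k t))) \<and>
     (AE t in lebesgue. 0 < t \<and> ereal t < T \<longrightarrow>
        \<rho>s t \<ge> 0 \<and> (\<forall>k\<in>{1..d}. Vbar k t \<in> V_set \<kappa> \<gamma> (\<rho>s t, 0))) \<and>
     (AE t in lebesgue. 0 < t \<and> ereal t < T \<longrightarrow>
        (\<Sum>k = 1..d. A k * fst (Vbar k t) * snd (Vbar k t)) = 0)"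

end

theory Submission
  imports Defs
begin

text \<open>Since \<open>G = \<rho> u h\<close>, mass conservation at the junction and (ii) give (i).  For (ii), follow the Lax
  solution from the state \<open>(\<rho>\<^sub>*, 0)\<close> up to the ray \<open>x/t = 0\<close>.  A 1-rarefaction produces \<open>u \<ge> 0\<close> and a
  state that is at most sonic, which bounds \<open>h\<close> from above.  A 1-shock produces \<open>u < 0\<close> and
  \<open>\<rho> > \<rho>\<^sub>*\<close>, which bounds \<open>h\<close> from below.  The 2-wave can reach the ray only when \<open>\<rho>\<^sub>* = 0\<close> or
  behind a 1-shock, and then a 2-rarefaction increases \<open>\<rho>\<close> further, while a 2-shock of speed \<open>s \<le> 0\<close> increases \<open>h\<close>.\<close>

section \<open>Rarefactions and the stagnation enthalpy\<close>

lemma a_const_pos: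
  assumes "\<kappa> > 0" "1 < \<gamma>"
  shows "a_const \<kappa> \<gamma> > 0"
  using assms by (simp add: a_const_def)

lemma theta_pos: "1 < \<gamma> \<Longrightarrow> theta \<gamma> > 0"
  by (simp add: theta_def)

text \<open>Since \<open>2 * theta \<gamma> = \<gamma> - 1\<close>, the variable
  \<open>\<rho> powr theta \<gamma>\<close> makes the enthalpy a quadratic form, while eigenvalues
  and Riemann invariants are linear in it and \<open>u\<close>. Rarefaction estimates thereby become
  algebra.\<close>

lemma stagnation_enthalpy_theta:
  assumes "\<kappa> > 0" "1 < \<gamma>"
  shows "stagnation_enthalpy \<kappa> \<gamma> V =
    (snd V)\<^sup>2 / 2 + sqrt (\<kappa> * \<gamma>) * a_const \<kappa> \<gamma> / 2 * (fst V powr theta \<gamma>)\<^sup>2"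
proof -
  have "sqrt (\<kappa> * \<gamma>) * a_const \<kappa> \<gamma> / 2 = (sqrt (\<kappa> * \<gamma>))\<^sup>2 / (\<gamma> - 1)"
    unfolding a_const_def power2_eq_square using assms by (simp add: field_simps)
  also have "\<dots> = \<kappa> * \<gamma> / (\<gamma> - 1)"
    using assms by simp
  finally have c: "sqrt (\<kappa> * \<gamma>) * a_const \<kappa> \<gamma> / 2 = \<kappa> * \<gamma> / (\<gamma> - 1)" .
  have p: "(fst V powr theta \<gamma>)\<^sup>2 = fst V powr (\<gamma> - 1)"
    unfolding power2_eq_square by (simp add: powr_add[symmetric] theta_def)
  show ?thesis
    unfolding c p stagnation_enthalpy_def ..
qed

lemma stagnation_enthalpy_at_rest_le:
  assumes "\<kappa> > 0" "1 < \<gamma>" "0 \<le> r" "r \<le> fst V"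
  shows "stagnation_enthalpy \<kappa> \<gamma> (r, 0) \<le> stagnation_enthalpy \<kappa> \<gamma> V"
proof -
  have "r powr (\<gamma> - 1) \<le> fst V powr (\<gamma> - 1)"
    using assms by (intro powr_mono2) auto
  then have "\<kappa> * \<gamma> / (\<gamma> - 1) * r powr (\<gamma> - 1) \<le> \<kappa> * \<gamma> / (\<gamma> - 1) * fst V powr (\<gamma> - 1)"
    using assms by (intro mult_left_mono) auto
  then show ?thesis
    by (simp add: stagnation_enthalpy_def add_increasing)
qed

text \<open>With \<open>x\<close>, \<open>y\<close> the powers of the two densities, the invariant
  gives \<open>u = a * (y - x)\<close>, so twice the enthalpy difference factors as
  \<open>u * (u - c * (y + x))\<close>. Here \<open>u \<le> c * x\<close> makes the second factor
  nonpositive.\<close>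

lemma rarefaction1_enthalpy_le:
  assumes "\<kappa> > 0" "1 < \<gamma>"
    and inv: "riemann_inv2 \<kappa> \<gamma> V = a_const \<kappa> \<gamma> * r powr theta \<gamma>"
    and subsonic: "lambda1 \<kappa> \<gamma> V \<le> 0" and "0 \<le> snd V"
  shows "stagnation_enthalpy \<kappa> \<gamma> V \<le> stagnation_enthalpy \<kappa> \<gamma> (r, 0)"
proof -
  define a where "a = a_const \<kappa> \<gamma>"
  define c where "c = sqrt (\<kappa> * \<gamma>)"
  define x where "x = fst V powr theta \<gamma>"
  define y where "y = r powr theta \<gamma>"
  define u where "u = snd V"
  have pos: "a > 0" "c > 0" "x \<ge> 0" "y \<ge> 0" "u \<ge> 0"
    using assms a_const_pos by (auto simp: a_def c_def x_def y_def u_def)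
  have u: "u = a * (y - x)" "u \<le> c * x"
    using inv subsonic by (auto simp: riemann_inv2_def lambda1_def a_def c_def x_def y_def u_def algebra_simps)
  have "u \<le> c * (y + x)"
    using u(2) pos by (simp add: distrib_left add_increasing)
  then have "u * u \<le> u * (c * (y + x))"
    using pos by (intro mult_left_mono)
  also have "\<dots> = c * a * y\<^sup>2 - c * a * x\<^sup>2"
    unfolding u(1) by (simp add: algebra_simps power2_eq_square)
  finally have "u\<^sup>2 / 2 + c * a / 2 * x\<^sup>2 \<le> c * a / 2 * y\<^sup>2"
    by (simp add: power2_eq_square field_simps)
  then show ?thesis
    unfolding stagnation_enthalpy_theta[OF assms(1,2)]
    by (simp add: a_def c_def x_def y_def u_def)
qed

section \<open>Limits of centred rarefactions along the junction\<close>

lemma conserved_inj_on_states: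
  assumes "V \<in> states" "W \<in> states" "conserved V = conserved W"
  shows "V = W"
  using assms by (auto simp: states_def conserved_def prod_eq_iff)

text \<open>Knowing the limit of the conserved variables only is no obstruction: if \<open>\<rho> = 0\<close> in the
  limit, then the Riemann invariant \<open>w\<close> has to vanish as well.\<close>

lemma fan_trace:
  fixes a c \<theta> w :: real
  assumes "0 < \<theta>" "a + c \<noteq> 0" and V: "V \<in> states" and F: "F \<noteq> bot" "F \<le> at_right 0"
    and lim: "((\<lambda>\<xi>. conserved (v \<xi>)) \<longlongrightarrow> conserved V) F"
    and ev: "eventually (\<lambda>\<xi>. v \<xi> \<in> states \<and> snd (v \<xi>) - c * fst (v \<xi>) powr \<theta> = \<xi> \<and>
      snd (v \<xi>) + a * fst (v \<xi>) powr \<theta> = w) F"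
  shows "snd V - c * fst V powr \<theta> = 0 \<and> snd V + a * fst V powr \<theta> = w"
proof -
  define x where "x = fst V powr \<theta>"
  have id: "((\<lambda>\<xi>. \<xi>) \<longlongrightarrow> 0) F"
    using F(2) by (metis tendsto_mono tendsto_ident_at)
  have rho: "((\<lambda>\<xi>. fst (v \<xi>)) \<longlongrightarrow> fst V) F"
    using tendsto_fst[OF lim] by (simp add: conserved_def)
  have mom: "((\<lambda>\<xi>. fst (v \<xi>) * snd (v \<xi>)) \<longlongrightarrow> fst V * snd V) F"
    using tendsto_snd[OF lim] by (simp add: conserved_def)
  have lx: "((\<lambda>\<xi>. fst (v \<xi>) powr \<theta>) \<longlongrightarrow> x) F"
    unfolding x_def using assms(1)
    by (intro tendsto_powr2[OF rho tendsto_const]) (auto intro!: eventually_mono[OF ev] simp: states_def)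
  \<comment> \<open>Subtracting the two fan equations eliminates the velocity, which need not
    converge a priori when the density tends to zero.\<close>
  have "((\<lambda>\<xi>. (a + c) * fst (v \<xi>) powr \<theta>) \<longlongrightarrow> (a + c) * x) F"
    by (intro tendsto_intros lx)
  moreover have "eventually (\<lambda>\<xi>. (a + c) * fst (v \<xi>) powr \<theta> = w - \<xi>) F"
    using ev by eventually_elim (auto simp: algebra_simps)
  ultimately have "((\<lambda>\<xi>. w - \<xi>) \<longlongrightarrow> (a + c) * x) F"
    using tendsto_cong by fast
  moreover have "((\<lambda>\<xi>. w - \<xi>) \<longlongrightarrow> w - 0) F"
    by (intro tendsto_intros id)
  ultimately have w: "w = (a + c) * x"
    using tendsto_unique[OF F(1)] by fastforce
  have "((\<lambda>\<xi>. fst (v \<xi>) * (w - a * fst (v \<xi>) powr \<theta>)) \<longlongrightarrow> fst V * (w - a * x)) F"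
    by (intro tendsto_intros lx rho)
  moreover have "eventually (\<lambda>\<xi>. fst (v \<xi>) * (w - a * fst (v \<xi>) powr \<theta>) = fst (v \<xi>) * snd (v \<xi>)) F"
    using ev by eventually_elim auto
  ultimately have "((\<lambda>\<xi>. fst (v \<xi>) * snd (v \<xi>)) \<longlongrightarrow> fst V * (w - a * x)) F"
    using tendsto_cong by fast
  then have "fst V * snd V = fst V * (w - a * x)"
    using mom tendsto_unique[OF F(1)] by blast
  then have "snd V = w - a * x"
    using V w by (auto simp: states_def x_def)
  then show ?thesis
    using w by (auto simp: x_def algebra_simps)
qed

text \<open>\<open>F\<close> stays abstract so that the same analysis serves the plain one-sided
  limit in \<open>V_set\<close> and the essential limit in \<open>junction_trace\<close>. The left
  edge may be \<open>0\<close> itself, because only positive \<open>\<xi>\<close> matter.\<close>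

lemma eventually_open_sector:
  fixes s s' :: real
  assumes "s \<le> 0" "0 < s'" "F \<le> at_right 0"
  shows "eventually (\<lambda>\<xi>. s < \<xi> \<and> \<xi> < s') F"
proof (rule filter_leD[OF assms(3)])
  show "eventually (\<lambda>\<xi>. s < \<xi> \<and> \<xi> < s') (at_right 0)"
    using eventually_at_right_real[OF assms(2)] by eventually_elim (use assms(1) in auto)
qed

lemma fan1_trace:
  assumes "\<kappa> > 0" "1 < \<gamma>" "V \<in> states" "F \<noteq> bot" "F \<le> at_right 0"
    and "((\<lambda>\<xi>. conserved (v \<xi>)) \<longlongrightarrow> conserved V) F"
    and "fan1 \<kappa> \<gamma> w s s' v" "s \<le> 0" "0 < s'"
  shows "lambda1 \<kappa> \<gamma> V = 0 \<and> riemann_inv2 \<kappa> \<gamma> V = w"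
  unfolding lambda1_def riemann_inv2_def
proof (rule fan_trace[where v = v and F = F])
  have "a_const \<kappa> \<gamma> > 0" "sqrt (\<kappa> * \<gamma>) > 0"
    using assms a_const_pos by auto
  then show "a_const \<kappa> \<gamma> + sqrt (\<kappa> * \<gamma>) \<noteq> 0"
    by linarith
  show "eventually (\<lambda>\<xi>. v \<xi> \<in> states \<and> snd (v \<xi>) - sqrt (\<kappa> * \<gamma>) * fst (v \<xi>) powr theta \<gamma> = \<xi> \<and>
      snd (v \<xi>) + a_const \<kappa> \<gamma> * fst (v \<xi>) powr theta \<gamma> = w) F"
    using eventually_open_sector[OF assms(8,9,5)]
    by eventually_elim (use assms(7) in \<open>auto simp: fan1_def lambda1_def riemann_inv2_def\<close>)
qed (use assms theta_pos in auto)

lemma fan2_trace: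
  assumes "\<kappa> > 0" "1 < \<gamma>" "V \<in> states" "F \<noteq> bot" "F \<le> at_right 0"
    and "((\<lambda>\<xi>. conserved (v \<xi>)) \<longlongrightarrow> conserved V) F"
    and "fan2 \<kappa> \<gamma> w s s' v" "s \<le> 0" "0 < s'"
  shows "lambda2 \<kappa> \<gamma> V = 0 \<and> riemann_inv1 \<kappa> \<gamma> V = w"
proof -
  \<comment> \<open>The 2-family is the 1-family with the signs of \<open>a\<close> and
    \<open>c\<close> reversed; this is why \<open>fan_trace\<close> asks only for
    \<open>a + c \<noteq> 0\<close>.\<close>
  have "snd V - (- sqrt (\<kappa> * \<gamma>)) * fst V powr theta \<gamma> = 0 \<and>
    snd V + (- a_const \<kappa> \<gamma>) * fst V powr theta \<gamma> = w"
  proof (rule fan_trace[where v = v and F = F])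
    have "a_const \<kappa> \<gamma> > 0" "sqrt (\<kappa> * \<gamma>) > 0"
      using assms a_const_pos by auto
    then show "- a_const \<kappa> \<gamma> + - sqrt (\<kappa> * \<gamma>) \<noteq> 0"
      by linarith
    show "eventually (\<lambda>\<xi>. v \<xi> \<in> states \<and> snd (v \<xi>) - (- sqrt (\<kappa> * \<gamma>)) * fst (v \<xi>) powr theta \<gamma> = \<xi> \<and>
        snd (v \<xi>) + (- a_const \<kappa> \<gamma>) * fst (v \<xi>) powr theta \<gamma> = w) F"
      using eventually_open_sector[OF assms(8,9,5)]
      by eventually_elim (use assms(7) in \<open>auto simp: fan2_def lambda2_def riemann_inv1_def\<close>)
  qed (use assms theta_pos in auto)
  then show ?thesis
    by (simp add: lambda2_def riemann_inv1_def)
qed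

section \<open>Shocks\<close>

text \<open>The sonic mass flux \<open>c * \<rho> powr (1 + \<theta>)\<close> grows with the
  density. With equal mass fluxes, the side moving slower than sound relative to the shock is
  therefore the denser one; Lax's inequalities supply the two speed bounds.\<close>

lemma supersonic_density_less:
  fixes c \<theta> \<rho> \<rho>' y z :: real
  assumes "0 < \<rho>" "0 < \<rho>'" "0 < c" "0 < \<theta>"
    and "y < c * \<rho> powr \<theta>" "c * \<rho>' powr \<theta> < z" "\<rho> * y = \<rho>' * z"
  shows "\<rho>' < \<rho>"
proof (rule ccontr)
  assume "\<not> \<rho>' < \<rho>"
  then have le: "\<rho> \<le> \<rho>'" by simp
  have "\<rho> * y < \<rho> * (c * \<rho> powr \<theta>)"
    using assms(1,5) by simp
  also have "\<dots> \<le> \<rho>' * (c * \<rho>' powr \<theta>)"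
    using assms le by (intro mult_mono powr_mono2) auto
  also have "\<dots> < \<rho>' * z"
    using assms by simp
  finally show False using assms by simp
qed

lemma rankine_hugoniot_mass:
  assumes "rankine_hugoniot \<kappa> \<gamma> L R s"
  shows "fst L * (snd L - s) = fst R * (snd R - s)"
  using assms by (simp add: rankine_hugoniot_def conserved_def flux_def algebra_simps)

lemma rankine_hugoniot_momentum:
  assumes "rankine_hugoniot \<kappa> \<gamma> L R s"
  shows "fst L * (snd L - s)\<^sup>2 + pressure \<kappa> \<gamma> (fst L) = fst R * (snd R - s)\<^sup>2 + pressure \<kappa> \<gamma> (fst R)"
proof -
  have m: "s * (fst R - fst L) = fst R * snd R - fst L * snd L"
    and n: "s * (fst R * snd R - fst L * snd L) =
      fst R * (snd R)\<^sup>2 + pressure \<kappa> \<gamma> (fst R) - (fst L * (snd L)\<^sup>2 + pressure \<kappa> \<gamma> (fst L))"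
    using assms by (auto simp: rankine_hugoniot_def conserved_def flux_def)
  \<comment> \<open>Passing to velocities relative to the shock creates terms in
    \<open>s\<^sup>2\<close>; the mass condition multiplied by \<open>s\<close> removes
    them.\<close>
  have "s * (s * (fst R - fst L)) = s * (fst R * snd R - fst L * snd L)"
    using m by simp
  then show ?thesis
    using n by (simp add: algebra_simps power2_eq_square)
qed

text \<open>The Lax condition puts \<open>s\<close> below \<open>lambda1\<close> of the state at
  rest, hence below zero. The gas at rest is then supersonic relative to the shock, so the density
  rises, and the mass condition \<open>\<rho> * u = s * (\<rho> - r)\<close> fixes the sign of the
  velocity.\<close>

lemma shock1_from_rest:
  assumes "\<kappa> > 0" "1 < \<gamma>" and sh: "shock1 \<kappa> \<gamma> (r, 0) M s"
  shows "s < 0" "snd M < 0" "r < fst M"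
proof -
  define c where "c = sqrt (\<kappa> * \<gamma>)"
  have c: "c > 0" using assms by (simp add: c_def)
  have lax: "0 < r" "0 < fst M" "snd M - c * fst M powr theta \<gamma> < s" "s < - c * r powr theta \<gamma>"
    and mass: "r * (- s) = fst M * (snd M - s)"
    using sh rankine_hugoniot_mass[of \<kappa> \<gamma> "(r, 0)" M s]
    by (auto simp: shock1_def lambda1_def c_def)
  show s: "s < 0"
  proof -
    have "0 \<le> c * r powr theta \<gamma>" using c by simp
    then show ?thesis using lax by simp
  qed
  show less: "r < fst M"
  proof (rule supersonic_density_less[OF lax(2,1) c theta_pos[OF assms(2)]])
    show "snd M - s < c * fst M powr theta \<gamma>" "c * r powr theta \<gamma> < - s"
      using lax(3,4) by simp_all
  qed (simp only: mass)
  have "fst M * snd M = s * (fst M - r)"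
    using mass by (simp add: algebra_simps)
  also have "\<dots> < 0"
    using s less by (simp add: mult_neg_pos)
  finally show "snd M < 0"
    using lax by (simp add: mult_less_0_iff)
qed

text \<open>Trapezoidal rule for the integral of the specific volume \<open>1 / \<rho>\<close>, a convex function of the
  pressure \<open>\<rho>\<^sup>\<gamma>\<close>; here \<open>p\<close> and \<open>q\<close> are densities.\<close>

lemma enthalpy_jump_le_trapezoid:
  fixes \<gamma> p q :: real
  assumes "1 < \<gamma>" "0 < p" "p \<le> q"
  shows "\<gamma> / (\<gamma> - 1) * (q powr (\<gamma> - 1) - p powr (\<gamma> - 1)) \<le>
    (q powr \<gamma> - p powr \<gamma>) * (1 / p + 1 / q) / 2"
proof -
  \<comment> \<open>Up to a constant, \<open>f x\<close> is the right-hand side minus the left-hand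
    side at \<open>q = x\<close>. Both sides vanish at \<open>q = p\<close>, so it suffices that
    \<open>f\<close> is nondecreasing from \<open>p\<close> on.\<close>
  define f where "f = (\<lambda>x. x powr \<gamma> / (2 * p) + x powr (\<gamma> - 1) / 2 - p powr \<gamma> / 2 * inverse x
    - \<gamma> / (\<gamma> - 1) * x powr (\<gamma> - 1))"
  define f' where "f' = (\<lambda>x. \<gamma> * x powr (\<gamma> - 1) / (2 * p) + (\<gamma> - 1) * x powr (\<gamma> - 2) / 2
    + p powr \<gamma> / 2 * inverse (x\<^sup>2) - \<gamma> * x powr (\<gamma> - 2))"
  have der: "(f has_real_derivative f' x) (at x)" if "p \<le> x" for x
  proof -
    have "x > 0" using that assms by simp
    then show ?thesis
      unfolding f_def f'_def using assms
      by (auto intro!: derivative_eq_intros simp: power2_eq_square)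
  qed
  have nonneg: "f' x \<ge> 0" if "p \<le> x" for x
  proof -
    have x: "x > 0" using that assms by simp
    have pw: "x powr (\<gamma> - 1) = x powr \<gamma> / x" "x powr (\<gamma> - 2) = x powr \<gamma> / x\<^sup>2"
      using x by (auto simp: powr_diff)
    \<comment> \<open>Young's inequality for the factors \<open>x powr \<gamma>\<close> and
      \<open>p\<close> with conjugate exponents \<open>(\<gamma> + 1) / \<gamma>\<close> and
      \<open>\<gamma> + 1\<close>; it is the sign condition on \<open>f'\<close> after clearing
      denominators.\<close>
    have "(x powr \<gamma> * p) \<le> \<gamma> / (\<gamma> + 1) * (x powr \<gamma> * x) + 1 / (\<gamma> + 1) * (p powr \<gamma> * p)"
    proof -
      have "x powr \<gamma> * p \<le> (x powr \<gamma>) powr ((\<gamma> + 1) / \<gamma>) / ((\<gamma> + 1) / \<gamma>) + p powr (\<gamma> + 1) / (\<gamma> + 1)"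
        using assms x by (intro Youngs_inequality) (auto simp: field_simps)
      moreover have "(x powr \<gamma>) powr ((\<gamma> + 1) / \<gamma>) = x powr \<gamma> * x"
        using assms x by (simp add: powr_powr powr_add)
      ultimately show ?thesis
        using assms by (simp add: powr_add mult.commute)
    qed
    then have "(\<gamma> + 1) * (x powr \<gamma> * p) \<le>
        (\<gamma> + 1) * (\<gamma> / (\<gamma> + 1) * (x powr \<gamma> * x) + 1 / (\<gamma> + 1) * (p powr \<gamma> * p))"
      using assms by (intro mult_left_mono) auto
    also have "\<dots> = \<gamma> * (x powr \<gamma> * x) + p powr \<gamma> * p"
      using assms by (simp add: distrib_left)
    finally have young: "(\<gamma> + 1) * (x powr \<gamma> * p) \<le> \<gamma> * (x powr \<gamma> * x) + p powr \<gamma> * p" .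
    have "2 * p * x\<^sup>2 * f' x = \<gamma> * (x powr \<gamma> * x) + p powr \<gamma> * p - (\<gamma> + 1) * (x powr \<gamma> * p)"
      unfolding f'_def pw using x assms by (simp add: field_simps power2_eq_square)
    with young have "0 \<le> 2 * p * x\<^sup>2 * f' x"
      by simp
    moreover have "0 < 2 * p * x\<^sup>2"
      using x assms by simp
    ultimately show ?thesis
      by (metis zero_le_mult_iff not_le)
  qed
  have "f p \<le> f q"
    using assms(3) by (rule DERIV_nonneg_imp_nondecreasing) (use der nonneg in blast)
  have trapezoid: "(Q - P) * (1 / p + 1 / q) / 2 = Q / (2 * p) + Q / q / 2 - P / p / 2 - P / 2 * inverse q"
    for P Q :: real
    using assms by (simp add: field_simps)
  have inv: "P / (2 * p) = P / p / 2" "P / 2 * inverse p = P / p / 2" for P :: real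
    using assms by (auto simp: field_simps)
  have "x powr (\<gamma> - 1) = x powr \<gamma> / x" if "0 < x" for x
    using that by (simp add: powr_diff)
  then have pw: "q powr (\<gamma> - 1) = q powr \<gamma> / q" "p powr (\<gamma> - 1) = p powr \<gamma> / p"
    using assms by auto
  show ?thesis
    using \<open>f p \<le> f q\<close> pw trapezoid[of "q powr \<gamma>" "p powr \<gamma>"] inv[of "p powr \<gamma>"]
    unfolding f_def right_diff_distrib by argo
qed

text \<open>In the frame of the shock the gas crosses from \<open>R\<close> to \<open>M\<close>, and
  by the trapezoidal rule its relative stagnation enthalpy does not increase on the way. Returning
  to the frame of the junction adds \<open>- s * (y - z)\<close> to the enthalpy of \<open>R\<close>
  minus that of \<open>M\<close>, which has the right sign for \<open>s \<le> 0\<close>.\<close>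

lemma shock2_left_moving:
  assumes "\<kappa> > 0" "1 < \<gamma>" and sh: "shock2 \<kappa> \<gamma> M R s" and "s \<le> 0"
  shows "snd M < 0" "snd R < 0" "stagnation_enthalpy \<kappa> \<gamma> M \<le> stagnation_enthalpy \<kappa> \<gamma> R"
proof -
  define c where "c = sqrt (\<kappa> * \<gamma>)"
  have c: "c > 0" using assms by (simp add: c_def)
  define p q y z where "p = fst R" "q = fst M" "y = snd M - s" "z = snd R - s"
  note defs = this
  have lax: "0 < q" "0 < p" "- y < c * q powr theta \<gamma>" "c * p powr theta \<gamma> < - z"
    and mass: "q * y = p * z"
    using sh rankine_hugoniot_mass[of \<kappa> \<gamma> M R s]
    by (auto simp: shock2_def lambda2_def c_def defs)
  have mom: "q * y\<^sup>2 + \<kappa> * q powr \<gamma> = p * z\<^sup>2 + \<kappa> * p powr \<gamma>"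
    using sh rankine_hugoniot_momentum[of \<kappa> \<gamma> M R s]
    by (auto simp: shock2_def pressure_def defs)
  have "0 \<le> c * p powr theta \<gamma>"
    using c by simp
  then have z: "z < 0"
    using lax by linarith
  then have "q * y < 0"
    using lax mass by (simp add: mult_pos_neg)
  then have y: "y < 0"
    using lax by (simp add: mult_less_0_iff)
  show "snd M < 0" "snd R < 0"
    using y z assms(4) by (auto simp: defs)
  have pq: "p < q"
    using supersonic_density_less[OF lax(1,2) c theta_pos[OF assms(2)] lax(3,4)] mass by simp
  have yz: "z \<le> y"
  proof -
    have "q * z \<le> p * z"
      using pq z by (intro mult_right_mono_neg) auto
    then show ?thesis
      unfolding mass[symmetric] using lax(1) by simp
  qed
  \<comment> \<open>With the common mass flux \<open>m = p * z = q * y\<close>, the pressure jump is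
    \<open>m * (z - y)\<close>, while \<open>m * (1 / p + 1 / q) = z + y\<close>; the product is a
    difference of squares.\<close>
  have jump: "\<kappa> * (q powr \<gamma> - p powr \<gamma>) * (1 / p + 1 / q) = z\<^sup>2 - y\<^sup>2"
  proof -
    have y_eq: "y = p * z / q"
      using mass lax(1) by (simp add: eq_divide_eq mult.commute)
    have "\<kappa> * (q powr \<gamma> - p powr \<gamma>) = p * z\<^sup>2 - q * y\<^sup>2"
      using mom by (simp add: algebra_simps)
    then have "\<kappa> * (q powr \<gamma> - p powr \<gamma>) * (1 / p + 1 / q) = (p * z\<^sup>2 - q * y\<^sup>2) * (1 / p + 1 / q)"
      by simp
    also have "\<dots> = z\<^sup>2 - y\<^sup>2"
      unfolding y_eq using lax by (simp add: field_simps power2_eq_square)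
    finally show ?thesis .
  qed
  have "\<kappa> * (\<gamma> / (\<gamma> - 1) * (q powr (\<gamma> - 1) - p powr (\<gamma> - 1))) \<le>
      \<kappa> * ((q powr \<gamma> - p powr \<gamma>) * (1 / p + 1 / q) / 2)"
    using enthalpy_jump_le_trapezoid[of \<gamma> p q] assms lax pq by (intro mult_left_mono) auto
  also have "\<dots> = (z\<^sup>2 - y\<^sup>2) / 2"
    using jump by simp
  finally have main: "\<kappa> * \<gamma> / (\<gamma> - 1) * (q powr (\<gamma> - 1) - p powr (\<gamma> - 1)) \<le> (z\<^sup>2 - y\<^sup>2) / 2"
    by simp
  have "s * (y - z) \<le> 0"
    using yz assms(4) by (simp add: mult_nonpos_nonneg)
  moreover have "(snd R)\<^sup>2 - (snd M)\<^sup>2 = z\<^sup>2 - y\<^sup>2 - 2 * (s * (y - z))"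
    by (simp add: defs power2_eq_square algebra_simps)
  ultimately have "(z\<^sup>2 - y\<^sup>2) / 2 \<le> ((snd R)\<^sup>2 - (snd M)\<^sup>2) / 2"
    by simp
  then show "stagnation_enthalpy \<kappa> \<gamma> M \<le> stagnation_enthalpy \<kappa> \<gamma> R"
    using main unfolding stagnation_enthalpy_def right_diff_distrib diff_divide_distrib defs(1,2)
    by linarith
qed
section \<open>Traces at the junction\<close>

lemma constant_trace:
  assumes "V \<in> states" "W \<in> states" "F \<noteq> bot"
    and "((\<lambda>\<xi>. conserved (v \<xi>)) \<longlongrightarrow> conserved V) F"
    and "eventually (\<lambda>\<xi>. v \<xi> = W) F"
  shows "V = W"
proof -
  have "((\<lambda>\<xi>. conserved (v \<xi>)) \<longlongrightarrow> conserved W) F"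
    using assms(5) by (intro tendsto_eventually) (auto elim: eventually_mono)
  then have "conserved V = conserved W"
    using assms(3,4) tendsto_unique by blast
  then show ?thesis
    by (rule conserved_inj_on_states[OF assms(1,2)])
qed

text \<open>The difference \<open>lambda2 - riemann_inv1\<close> is
  \<open>(a + c) * \<rho> powr \<theta>\<close> with \<open>a\<close>, \<open>c\<close> positive, so
  along a fixed invariant the speed orders the densities.\<close>

lemma rarefaction2_density_le:
  assumes "\<kappa> > 0" "1 < \<gamma>" "0 \<le> fst V" "riemann_inv1 \<kappa> \<gamma> V = riemann_inv1 \<kappa> \<gamma> M"
    and "lambda2 \<kappa> \<gamma> M \<le> lambda2 \<kappa> \<gamma> V"
  shows "fst M \<le> fst V"
proof (rule ccontr)
  assume "\<not> fst M \<le> fst V"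
  then have "fst V powr theta \<gamma> < fst M powr theta \<gamma>"
    using assms theta_pos by (intro powr_less_mono2) auto
  moreover have "a_const \<kappa> \<gamma> + sqrt (\<kappa> * \<gamma>) > 0"
    using assms a_const_pos by (simp add: add_pos_pos)
  ultimately have "(a_const \<kappa> \<gamma> + sqrt (\<kappa> * \<gamma>)) * fst V powr theta \<gamma> <
      (a_const \<kappa> \<gamma> + sqrt (\<kappa> * \<gamma>)) * fst M powr theta \<gamma>"
    by simp
  then show False
    using assms(4,5) by (simp add: riemann_inv1_def lambda2_def algebra_simps)
qed

lemma lambda2_nonpos_imp:
  assumes "\<kappa> > 0" "1 < \<gamma>" "0 < fst V" "lambda2 \<kappa> \<gamma> V \<le> 0"
  shows "snd V < 0"
proof -
  have "sqrt (\<kappa> * \<gamma>) * fst V powr theta \<gamma> > 0"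
    using assms by simp
  then show ?thesis
    using assms(4) by (simp add: lambda2_def)
qed

text \<open>This treats a 2-wave that starts at or to the left of the ray, so that the trace lies in
  the fan or is \<open>R\<close>. Used contrapositively, \<open>0 \<le> snd M\<close> forces the
  wave to start strictly to the right, leaving \<open>M\<close> next to the junction.\<close>

lemma wave2_trace:
  assumes "\<kappa> > 0" "1 < \<gamma>" "V \<in> states" "R \<in> states" "F \<noteq> bot" "F \<le> at_right 0"
    and "((\<lambda>\<xi>. conserved (v \<xi>)) \<longlongrightarrow> conserved V) F"
    and w: "wave2 \<kappa> \<gamma> M R s s' v" and tail: "\<forall>\<xi>>s'. v \<xi> = R"
    and "0 < fst M" "s \<le> 0"
  shows "snd M < 0 \<and> snd V < 0 \<and>
    (fst M \<le> fst V \<or> stagnation_enthalpy \<kappa> \<gamma> M \<le> stagnation_enthalpy \<kappa> \<gamma> V)"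
proof -
  have at_R: "V = R" if "s' \<le> 0"
  proof (rule constant_trace[OF assms(3,4,5,7)])
    show "eventually (\<lambda>\<xi>. v \<xi> = R) F"
      using eventually_open_sector[OF that zero_less_one assms(6)]
      by eventually_elim (use tail in auto)
  qed
  from w consider
      (fan) "s = lambda2 \<kappa> \<gamma> M" "s' = lambda2 \<kappa> \<gamma> R" "s \<le> s'" "0 < fst R"
        "riemann_inv1 \<kappa> \<gamma> M = riemann_inv1 \<kappa> \<gamma> R" "fan2 \<kappa> \<gamma> (riemann_inv1 \<kappa> \<gamma> R) s s' v"
    | (shock) "s' = s" "shock2 \<kappa> \<gamma> M R s"
    using assms(10) by (auto simp: wave2_def)
  then show ?thesis
  proof cases
    case fan
    \<comment> \<open>Inside the fan \<open>lambda2\<close> of the trace is \<open>0\<close>; to the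
      right of it the trace is \<open>R\<close> and \<open>lambda2\<close> is the edge speed
      \<open>s' \<le> 0\<close>. Both positions thus give the same three facts.\<close>
    have "riemann_inv1 \<kappa> \<gamma> V = riemann_inv1 \<kappa> \<gamma> M \<and> lambda2 \<kappa> \<gamma> M \<le> lambda2 \<kappa> \<gamma> V \<and> lambda2 \<kappa> \<gamma> V \<le> 0"
    proof (cases "s' \<le> 0")
      case True
      then show ?thesis using at_R fan by simp
    next
      case False
      then show ?thesis
        using fan2_trace[OF assms(1,2,3,5,6,7) fan(6) assms(11)] fan assms(11) by simp
    qed
    moreover have "0 \<le> fst V" using assms(3) by (auto simp: states_def)
    ultimately have "fst M \<le> fst V" "lambda2 \<kappa> \<gamma> V \<le> 0"
      using rarefaction2_density_le[OF assms(1,2)] by auto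
    then show ?thesis
      using lambda2_nonpos_imp[OF assms(1,2)] assms(10,11) fan(1) by auto
  next
    case shock
    then show ?thesis
      using shock2_left_moving[OF assms(1,2) shock(2) assms(11)] at_R assms(11) by auto
  qed
qed

text \<open>A 2-wave leaving vacuum is a rarefaction or trivial. A trace of positive density would
  have \<open>lambda2 \<le> 0\<close>, hence negative velocity.\<close>

lemma vacuum_trace_of_nonneg_velocity:
  assumes "\<kappa> > 0" "1 < \<gamma>" "V \<in> states" "R \<in> states" "F \<noteq> bot" "F \<le> at_right 0"
    and "((\<lambda>\<xi>. conserved (v \<xi>)) \<longlongrightarrow> conserved V) F"
    and w: "wave2 \<kappa> \<gamma> (0, 0) R s s' v" and tail: "\<forall>\<xi>>s'. v \<xi> = R"
    and "s \<le> 0" "0 \<le> snd V"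
  shows "V = (0, 0)"
proof -
  have at_R: "V = R" if "s' \<le> 0"
  proof (rule constant_trace[OF assms(3,4,5,7)])
    show "eventually (\<lambda>\<xi>. v \<xi> = R) F"
      using eventually_open_sector[OF that zero_less_one assms(6)]
      by eventually_elim (use tail in auto)
  qed
  from w consider
      (fan) "0 < fst R" "s' = lambda2 \<kappa> \<gamma> R" "fan2 \<kappa> \<gamma> (riemann_inv1 \<kappa> \<gamma> R) s s' v"
    | (vacuum) "R = (0, 0)" "s' = s"
    by (auto simp: wave2_def shock2_def)
  then show ?thesis
  proof cases
    case fan
    have "lambda2 \<kappa> \<gamma> V \<le> 0"
    proof (cases "s' \<le> 0")
      case True
      then show ?thesis using at_R fan by simp
    next
      case False
      then show ?thesis
        using fan2_trace[OF assms(1,2,3,5,6,7) fan(3) assms(10)] by simp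
    qed
    then have "\<not> 0 < fst V"
      using lambda2_nonpos_imp[OF assms(1,2), of V] assms(11) by linarith
    then show ?thesis
      using assms(3) by (auto simp: states_def)
  next
    case vacuum
    then show ?thesis using at_R assms(10) by simp
  qed
qed

text \<open>The proof locates the ray among the waves. For \<open>r > 0\<close> the left state never
  reaches it, because both a 1-rarefaction and a 1-shock issuing from rest have a negative left
  edge; for \<open>r = 0\<close> the middle state is vacuum too.\<close>

lemma lax_trace_enthalpy:
  assumes "\<kappa> > 0" "1 < \<gamma>" "0 \<le> r" "R \<in> states" "V \<in> states" "F \<noteq> bot" "F \<le> at_right 0"
    and "((\<lambda>\<xi>. conserved (v \<xi>)) \<longlongrightarrow> conserved V) F"
    and lax: "lax_solution \<kappa> \<gamma> (r, 0) R v"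
  shows "(0 \<le> snd V \<longrightarrow> stagnation_enthalpy \<kappa> \<gamma> V \<le> stagnation_enthalpy \<kappa> \<gamma> (r, 0)) \<and>
    (snd V \<le> 0 \<longrightarrow> stagnation_enthalpy \<kappa> \<gamma> (r, 0) \<le> stagnation_enthalpy \<kappa> \<gamma> V)"
proof -
  obtain M s1 s2 s3 s4 where M: "M \<in> states" and s: "s2 \<le> s3"
    and w1: "wave1 \<kappa> \<gamma> (r, 0) M s1 s2 v" and w2: "wave2 \<kappa> \<gamma> M R s3 s4 v"
    and left: "\<forall>\<xi><s1. v \<xi> = (r, 0)" and mid: "\<forall>\<xi>. s2 < \<xi> \<and> \<xi> < s3 \<longrightarrow> v \<xi> = M"
    and right: "\<forall>\<xi>>s4. v \<xi> = R"
    using lax by (auto simp: lax_solution_def)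
  have at_M: "V = M" if "s2 \<le> 0" "0 < s3"
  proof (rule constant_trace[OF assms(5) M assms(6,8)])
    show "eventually (\<lambda>\<xi>. v \<xi> = M) F"
      using eventually_open_sector[OF that assms(7)] by eventually_elim (use mid in auto)
  qed
  note after_M = wave2_trace[OF assms(1,2,5,4,6,7,8) w2 right]
  have rest: "stagnation_enthalpy \<kappa> \<gamma> (r, 0) \<le> stagnation_enthalpy \<kappa> \<gamma> W" if "r \<le> fst W" for W
    using stagnation_enthalpy_at_rest_le[OF assms(1,2,3) that] .
  show ?thesis
  proof (cases "r = 0")
    case True
    have M0: "M = (0, 0)" "s1 = s2"
      using w1 True by (auto simp: wave1_def shock1_def)
    have "0 \<le> fst V" using assms(5) by (auto simp: states_def)
    then have "stagnation_enthalpy \<kappa> \<gamma> (r, 0) \<le> stagnation_enthalpy \<kappa> \<gamma> V"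
      using rest True by simp
    moreover have "V = (0, 0)" if "0 \<le> snd V"
    proof -
      \<comment> \<open>The speed \<open>s1 = s2\<close> of the absent 1-wave is arbitrary, so the
        ray may even lie to its left; the state there is vacuum as well.\<close>
      consider "0 < s1" | "s2 \<le> 0" "0 < s3" | "s3 \<le> 0"
        using M0(2) s by linarith
      then show ?thesis
      proof cases
        case 1
        have "eventually (\<lambda>\<xi>. v \<xi> = (0, 0)) F"
          using eventually_open_sector[OF order_refl 1 assms(7)]
          by eventually_elim (use left True in auto)
        then show ?thesis
          using constant_trace[OF assms(5) _ assms(6,8)] M M0 by blast
      next
        case 2
        then show ?thesis using at_M M0 by simp
      next
        case 3
        then show ?thesis
          using vacuum_trace_of_nonneg_velocity[OF assms(1,2,5,4,6,7,8) _ right 3 that] w2 M0 by simp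
      qed
    qed
    ultimately show ?thesis using True by auto
  next
    case False
    define a where "a = a_const \<kappa> \<gamma>"
    define c where "c = sqrt (\<kappa> * \<gamma>)"
    define y where "y = r powr theta \<gamma>"
    have pos: "0 < r" "0 < a" "0 < c" "0 < y"
      using False assms(1-3) a_const_pos by (auto simp: a_def c_def y_def)
    have L: "lambda1 \<kappa> \<gamma> (r, 0) = - (c * y)" "riemann_inv2 \<kappa> \<gamma> (r, 0) = a * y"
      by (auto simp: lambda1_def riemann_inv2_def a_def c_def y_def)
    have cy: "0 < c * y" "0 < a * y" using pos by auto
    \<comment> \<open>The ray inside a 1-fan, whether or not it ends in vacuum: the trace is sonic
      with strictly positive velocity, so only the upper bound is at stake.\<close>
    have sonic: ?thesis if fan: "fan1 \<kappa> \<gamma> (a * y) s1 s2 v" and "s1 \<le> 0" "0 < s2"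
    proof -
      have V: "lambda1 \<kappa> \<gamma> V = 0" "riemann_inv2 \<kappa> \<gamma> V = a * y"
        using fan1_trace[OF assms(1,2,5,6,7,8) that] by auto
      have "0 < snd V"
      proof -
        have u: "snd V = c * fst V powr theta \<gamma>" "snd V = a * y - a * fst V powr theta \<gamma>"
          using V by (auto simp: lambda1_def riemann_inv2_def a_def c_def)
        show ?thesis
        proof (cases "fst V = 0")
          case True
          then show ?thesis using u(2) cy by simp
        next
          case False
          then show ?thesis using u(1) pos by simp
        qed
      qed
      then show ?thesis
        using rarefaction1_enthalpy_le[OF assms(1,2)] V by (simp add: a_def y_def)
    qed
    from w1 pos consider
        (fan) "0 < fst M" "s1 = lambda1 \<kappa> \<gamma> (r, 0)" "s2 = lambda1 \<kappa> \<gamma> M" "s1 \<le> s2"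
          "riemann_inv2 \<kappa> \<gamma> M = a * y" "fan1 \<kappa> \<gamma> (a * y) s1 s2 v"
      | (shock) "s2 = s1" "shock1 \<kappa> \<gamma> (r, 0) M s1"
      | (vacuum) "s1 = lambda1 \<kappa> \<gamma> (r, 0)" "s2 = a * y" "fan1 \<kappa> \<gamma> (a * y) s1 s2 v"
      unfolding wave1_def L by auto
    then show ?thesis
    proof cases
      case fan
      show ?thesis
      proof (cases "0 < s2")
        case True
        then show ?thesis using sonic fan cy L by simp
      next
        case False
        define x where "x = fst M powr theta \<gamma>"
        have u: "snd M = a * (y - x)" "- (c * y) \<le> snd M - c * x"
          using fan L by (auto simp: lambda1_def riemann_inv2_def a_def c_def x_def algebra_simps)
        \<comment> \<open>The ordering \<open>s1 \<le> s2\<close> of the fan edges means that the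
          density cannot rise across a 1-rarefaction; the invariant then makes the velocity
          nonnegative.\<close>
        have "0 \<le> (a + c) * (y - x)"
          using u by (simp add: algebra_simps)
        then have "0 \<le> y - x"
          using pos by (simp add: zero_le_mult_iff)
        then have nonneg: "0 \<le> snd M"
          using u pos by simp
        have "0 < s3"
          using after_M[OF fan(1)] nonneg by (meson not_less)
        then have VM: "V = M"
          using at_M False by simp
        have "stagnation_enthalpy \<kappa> \<gamma> M \<le> stagnation_enthalpy \<kappa> \<gamma> (r, 0)"
          using rarefaction1_enthalpy_le[OF assms(1,2)] fan False nonneg by (simp add: a_def y_def)
        \<comment> \<open>At zero velocity both bounds are required; there the invariant gives
          \<open>x = y\<close>, and the enthalpies coincide.\<close>
        moreover have "stagnation_enthalpy \<kappa> \<gamma> (r, 0) \<le> stagnation_enthalpy \<kappa> \<gamma> M" if "snd M \<le> 0"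
        proof -
          have "snd M = 0" "x = y" using that nonneg u(1) pos by auto
          then show ?thesis
            by (simp add: stagnation_enthalpy_theta[OF assms(1,2)] x_def y_def)
        qed
        ultimately show ?thesis using VM by simp
      qed
    next
      case shock
      note sh = shock1_from_rest[OF assms(1,2) shock(2)]
      \<comment> \<open>The trace is \<open>M\<close> or lies in or behind the 2-wave. In the second
        case either its density exceeds \<open>r\<close>, or its enthalpy dominates that of
        \<open>M\<close>, whose density does.\<close>
      have "snd V < 0 \<and> stagnation_enthalpy \<kappa> \<gamma> (r, 0) \<le> stagnation_enthalpy \<kappa> \<gamma> V"
      proof (cases "0 < s3")
        case True
        then show ?thesis using at_M sh shock rest by simp
      next
        case False
        then have "snd V < 0" "fst M \<le> fst V \<or> stagnation_enthalpy \<kappa> \<gamma> M \<le> stagnation_enthalpy \<kappa> \<gamma> V"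
          using after_M sh(3) pos by auto
        then show ?thesis
          using rest[of M] rest[of V] sh(3) by auto
      qed
      then show ?thesis by auto
    next
      case vacuum
      then show ?thesis using sonic cy L by simp
    qed
  qed
qed

section \<open>Traces of the Cauchy and Riemann problems\<close>

lemma V_set_enthalpy:
  assumes "\<kappa> > 0" "1 < \<gamma>" "0 \<le> r" "V \<in> V_set \<kappa> \<gamma> (r, 0)"
  shows "(0 \<le> snd V \<longrightarrow> stagnation_enthalpy \<kappa> \<gamma> V \<le> stagnation_enthalpy \<kappa> \<gamma> (r, 0)) \<and>
    (snd V \<le> 0 \<longrightarrow> stagnation_enthalpy \<kappa> \<gamma> (r, 0) \<le> stagnation_enthalpy \<kappa> \<gamma> V)"
proof -
  obtain R v where V: "V \<in> states" "R \<in> states" "lax_solution \<kappa> \<gamma> (r, 0) R v" "(v \<longlongrightarrow> V) (at_right 0)"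
    using assms(4) unfolding V_set_def by blast
  have "((\<lambda>\<xi>. conserved (v \<xi>)) \<longlongrightarrow> conserved V) (at_right 0)"
    unfolding conserved_def by (intro tendsto_intros V(4))
  then show ?thesis
    using lax_trace_enthalpy[OF assms(1-3) V(2,1) _ order_refl _ V(3)] by simp
qed

text \<open>This makes essential limits at the junction unique: every interval
  \<open>{0<..<b}\<close> with \<open>b > 0\<close> has positive measure and so meets each set of
  full measure.\<close>

lemma inf_at_right_ae_filter_neq_bot: "inf (at_right (0::real)) (ae_filter lebesgue) \<noteq> bot"
proof
  assume "inf (at_right (0::real)) (ae_filter lebesgue) = bot"
  then have "eventually (\<lambda>x. False) (inf (at_right (0::real)) (ae_filter lebesgue))"
    by simp
  then obtain P Q where P: "eventually P (at_right (0::real))" and Q: "AE x in lebesgue. Q x"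
    and PQ: "\<And>x. P x \<Longrightarrow> Q x \<Longrightarrow> False"
    by (auto simp: eventually_inf)
  obtain b where b: "0 < b" "\<And>x. 0 < x \<Longrightarrow> x < b \<Longrightarrow> P x"
    using P by (auto simp: eventually_at_right_field)
  have "AE x in lebesgue. x \<notin> {0<..<b}"
    using Q by eventually_elim (use b PQ in auto)
  then have "emeasure lebesgue {0<..<b} = 0"
    by (subst (asm) AE_iff_measurable[where N = "{0<..<b}"]) auto
  then show False using b(1) by simp
qed

lemma gen_riemann_trace_enthalpy:
  assumes "\<kappa> > 0" "1 < \<gamma>" and sol: "gen_riemann_solution \<kappa> \<gamma> d A Vhat V Vbar r"
    and k: "k \<in> {1..d}" and t: "0 < t"
  shows "(0 \<le> snd (Vbar k t) \<longrightarrow>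
      stagnation_enthalpy \<kappa> \<gamma> (Vbar k t) \<le> stagnation_enthalpy \<kappa> \<gamma> (r, 0)) \<and>
    (snd (Vbar k t) \<le> 0 \<longrightarrow>
      stagnation_enthalpy \<kappa> \<gamma> (r, 0) \<le> stagnation_enthalpy \<kappa> \<gamma> (Vbar k t))"
proof -
  define F where "F = inf (at_right (0::real)) (ae_filter lebesgue)"
  have "\<exists>v. lax_solution \<kappa> \<gamma> (r, 0) (Vhat k) v \<and> (\<forall>t>0. \<forall>x>0. V k t x = v (x / t))"
    using sol k unfolding gen_riemann_solution_def by blast
  then obtain v where lax: "lax_solution \<kappa> \<gamma> (r, 0) (Vhat k) v"
    and v: "\<And>x. 0 < x \<Longrightarrow> V k t x = v (x / t)"
    using t by blast
  have r: "0 \<le> r" and R: "Vhat k \<in> states" and "junction_trace (V k t) (Vbar k t)"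
    using sol k t by (simp_all add: gen_riemann_solution_def)
  then have tr: "Vbar k t \<in> states" "((\<lambda>x. conserved (V k t x)) \<longlongrightarrow> conserved (Vbar k t)) F"
    by (simp_all add: junction_trace_def F_def)
  \<comment> \<open>By self-similarity the trace in \<open>x\<close> at fixed \<open>t\<close> is a
    limit of the profile along the image of \<open>F\<close> under division by \<open>t\<close>.
    That image is again finer than \<open>at_right 0\<close>, so the analysis of the profile applies
    to it.\<close>
  have "filterlim (\<lambda>x. x / t) (at_right 0) (at_right 0)"
    unfolding filterlim_at using t
    by (auto intro!: tendsto_eq_intros eventually_mono[OF eventually_at_right_less])
  then have le: "filtermap (\<lambda>x. x / t) F \<le> at_right 0"
    unfolding F_def filterlim_def by (meson filtermap_mono inf_le1 order_trans)
  have "eventually (\<lambda>x. 0 < x) F"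
    unfolding F_def by (rule filter_leD[OF inf_le1]) (rule eventually_at_right_less)
  then have "eventually (\<lambda>x. conserved (V k t x) = conserved (v (x / t))) F"
    by eventually_elim (simp add: v)
  then have "((\<lambda>x. conserved (v (x / t))) \<longlongrightarrow> conserved (Vbar k t)) F"
    using tr(2) tendsto_cong by fast
  then have "((\<lambda>\<xi>. conserved (v \<xi>)) \<longlongrightarrow> conserved (Vbar k t)) (filtermap (\<lambda>x. x / t) F)"
    by (simp add: filterlim_filtermap)
  moreover have "filtermap (\<lambda>x. x / t) F \<noteq> bot"
    using inf_at_right_ae_filter_neq_bot by (simp add: F_def filtermap_bot_iff)
  ultimately show ?thesis
    using lax_trace_enthalpy[OF assms(1,2) r R tr(1) _ le _ lax] by blast
qed

section \<open>From enthalpy bounds to energy dissipation\<close>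

lemma energy_flux_eq:
  assumes "0 \<le> fst V"
  shows "energy_flux \<kappa> \<gamma> V = fst V * snd V * stagnation_enthalpy \<kappa> \<gamma> V"
proof -
  have "fst V powr \<gamma> = fst V * fst V powr (\<gamma> - 1)"
    using assms by (cases "fst V = 0") (auto simp: powr_diff)
  then show ?thesis
    by (simp add: energy_flux_def stagnation_enthalpy_def algebra_simps power2_eq_square power3_eq_cube)
qed

text \<open>Outflow into the pipes carries enthalpy at most \<open>h\<close> and flow to the
  junction at least \<open>h\<close>, so for either sign of the velocity replacing the enthalpy by
  \<open>h\<close> can only increase a term. The resulting sum is \<open>h\<close> times the total
  mass flux, which is zero.\<close>

lemma energy_dissipation:
  fixes A :: "nat \<Rightarrow> real"
  assumes "\<And>k. k \<in> K \<Longrightarrow> 0 < A k" "\<And>k. k \<in> K \<Longrightarrow> 0 \<le> fst (W k)"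
    and le: "\<And>k. k \<in> K \<Longrightarrow> 0 \<le> snd (W k) \<Longrightarrow> stagnation_enthalpy \<kappa> \<gamma> (W k) \<le> h"
    and ge: "\<And>k. k \<in> K \<Longrightarrow> snd (W k) \<le> 0 \<Longrightarrow> h \<le> stagnation_enthalpy \<kappa> \<gamma> (W k)"
    and mass: "(\<Sum>k\<in>K. A k * fst (W k) * snd (W k)) = 0"
  shows "(\<Sum>k\<in>K. A k * energy_flux \<kappa> \<gamma> (W k)) \<le> 0"
proof -
  have "A k * energy_flux \<kappa> \<gamma> (W k) \<le> A k * fst (W k) * snd (W k) * h" if k: "k \<in> K" for k
  proof -
    have "snd (W k) * stagnation_enthalpy \<kappa> \<gamma> (W k) \<le> snd (W k) * h"
      using le[OF k] ge[OF k] by (cases "0 \<le> snd (W k)") (auto intro: mult_left_mono mult_left_mono_neg)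
    then have "A k * fst (W k) * (snd (W k) * stagnation_enthalpy \<kappa> \<gamma> (W k)) \<le>
        A k * fst (W k) * (snd (W k) * h)"
      by (rule mult_left_mono) (use assms(1,2)[OF k] in simp)
    then show ?thesis
      using assms(2)[OF k] by (simp add: energy_flux_eq mult.assoc)
  qed
  then have "(\<Sum>k\<in>K. A k * energy_flux \<kappa> \<gamma> (W k)) \<le> (\<Sum>k\<in>K. A k * fst (W k) * snd (W k) * h)"
    by (rule sum_mono)
  also have "\<dots> = 0"
    using mass by (simp add: sum_distrib_right[symmetric])
  finally show ?thesis .
qed

theorem corollary1:
  fixes \<kappa> \<gamma> :: real and d :: nat and A :: "nat \<Rightarrow> real" and T :: ereal
    and V :: "nat \<Rightarrow> real \<Rightarrow> real \<Rightarrow> real \<times> real"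
    and Vbar :: "nat \<Rightarrow> real \<Rightarrow> real \<times> real"
    and \<rho>s :: "real \<Rightarrow> real"
    and Rhat :: "nat \<Rightarrow> real \<times> real"
    and U0 :: "nat \<Rightarrow> real \<times> real" and Chat :: "nat \<Rightarrow> real \<Rightarrow> real \<times> real"
  assumes "\<kappa> > 0" and "1 < \<gamma>" and "\<gamma> < 3"
    and "\<And>k. k \<in> {1..d} \<Longrightarrow> A k > 0"
    and "(T = \<infinity> \<and> (\<exists>r. \<rho>s = (\<lambda>t. r) \<and> gen_riemann_solution \<kappa> \<gamma> d A Rhat V Vbar r)) \<or>
         gen_cauchy_solution \<kappa> \<gamma> d A U0 Chat T V Vbar \<rho>s"
  shows "(AE t in lebesgue. 0 < t \<and> ereal t < T \<longrightarrow>
            (\<Sum>k = 1..d. A k * energy_flux \<kappa> \<gamma> (Vbar k t)) \<le> 0) \<and>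
         (AE t in lebesgue. 0 < t \<and> ereal t < T \<longrightarrow>
            (\<forall>k\<in>{1..d}. \<forall>l\<in>{1..d}. snd (Vbar l t) \<le> 0 \<and> 0 \<le> snd (Vbar k t) \<longrightarrow>
               stagnation_enthalpy \<kappa> \<gamma> (Vbar k t) \<le> stagnation_enthalpy \<kappa> \<gamma> (\<rho>s t, 0) \<and>
               stagnation_enthalpy \<kappa> \<gamma> (\<rho>s t, 0) \<le> stagnation_enthalpy \<kappa> \<gamma> (Vbar l t)))"
proof -
  \<comment> \<open>\<open>admissible\<close> compares a single trace with the common threshold
    \<open>h\<close>: applied to two traces it gives (ii), and summed with the mass fluxes as
    weights it gives (i).\<close>
  define admissible where "admissible W h \<longleftrightarrow>
      (0 \<le> snd W \<longrightarrow> stagnation_enthalpy \<kappa> \<gamma> W \<le> h) \<and> (snd W \<le> 0 \<longrightarrow> h \<le> stagnation_enthalpy \<kappa> \<gamma> W)"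
    for W h
  have ae: "AE t in lebesgue. 0 < t \<and> ereal t < T \<longrightarrow>
      (\<forall>k\<in>{1..d}. 0 \<le> fst (Vbar k t) \<and> admissible (Vbar k t) (stagnation_enthalpy \<kappa> \<gamma> (\<rho>s t, 0))) \<and>
      (\<Sum>k = 1..d. A k * fst (Vbar k t) * snd (Vbar k t)) = 0"
    using assms(5)
  proof (elim disjE conjE exE)
    fix r assume r: "\<rho>s = (\<lambda>t. r)" and sol: "gen_riemann_solution \<kappa> \<gamma> d A Rhat V Vbar r"
    have "(\<forall>k\<in>{1..d}. 0 \<le> fst (Vbar k t) \<and> admissible (Vbar k t) (stagnation_enthalpy \<kappa> \<gamma> (\<rho>s t, 0))) \<and>
      (\<Sum>k = 1..d. A k * fst (Vbar k t) * snd (Vbar k t)) = 0" if t: "0 < t" for t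
    proof (intro conjI ballI)
      show "(\<Sum>k = 1..d. A k * fst (Vbar k t) * snd (Vbar k t)) = 0"
        using sol t unfolding gen_riemann_solution_def by blast
      fix k assume k: "k \<in> {1..d}"
      show "0 \<le> fst (Vbar k t)"
      proof -
        have "Vbar k t \<in> states"
          using sol t k unfolding gen_riemann_solution_def junction_trace_def by blast
        then show ?thesis by (auto simp: states_def)
      qed
      show "admissible (Vbar k t) (stagnation_enthalpy \<kappa> \<gamma> (\<rho>s t, 0))"
        unfolding admissible_def r by (rule gen_riemann_trace_enthalpy[OF assms(1,2) sol k t])
    qed
    \<comment> \<open>In the Riemann case the properties hold for every \<open>t > 0\<close>, so the
      exceptional set is empty.\<close>
    then show ?thesis by (intro AE_I2) blast
  next
    assume sol: "gen_cauchy_solution \<kappa> \<gamma> d A U0 Chat T V Vbar \<rho>s"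
    have "AE t in lebesgue. 0 < t \<and> ereal t < T \<longrightarrow>
        0 \<le> \<rho>s t \<and> (\<forall>k\<in>{1..d}. Vbar k t \<in> V_set \<kappa> \<gamma> (\<rho>s t, 0))"
      and "AE t in lebesgue. 0 < t \<and> ereal t < T \<longrightarrow>
        (\<Sum>k = 1..d. A k * fst (Vbar k t) * snd (Vbar k t)) = 0"
      using sol unfolding gen_cauchy_solution_def by blast+
    then show ?thesis
    proof eventually_elim
      case (elim t)
      have "0 \<le> fst W" if "W \<in> V_set \<kappa> \<gamma> (\<rho>s t, 0)" for W
        using that by (auto simp: V_set_def states_def)
      then show ?case
        using elim V_set_enthalpy[OF assms(1,2)] unfolding admissible_def by blast
    qed
  qed
  show ?thesis
  proof
    show "AE t in lebesgue. 0 < t \<and> ereal t < T \<longrightarrow> (\<Sum>k = 1..d. A k * energy_flux \<kappa> \<gamma> (Vbar k t)) \<le> 0"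
      using ae
    proof eventually_elim
      case (elim t)
      show ?case
        using elim assms(4)
        by (auto simp: admissible_def intro!: energy_dissipation[where h = "stagnation_enthalpy \<kappa> \<gamma> (\<rho>s t, 0)"])
    qed
    show "AE t in lebesgue. 0 < t \<and> ereal t < T \<longrightarrow>
            (\<forall>k\<in>{1..d}. \<forall>l\<in>{1..d}. snd (Vbar l t) \<le> 0 \<and> 0 \<le> snd (Vbar k t) \<longrightarrow>
               stagnation_enthalpy \<kappa> \<gamma> (Vbar k t) \<le> stagnation_enthalpy \<kappa> \<gamma> (\<rho>s t, 0) \<and>
               stagnation_enthalpy \<kappa> \<gamma> (\<rho>s t, 0) \<le> stagnation_enthalpy \<kappa> \<gamma> (Vbar l t))"
      using ae by eventually_elim (auto simp: admissible_def)
  qed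
qed

end
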